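(* Let $N\ge 1$ be an integer, let $V,V'\subseteq[N]$ with $V\cap V'=\emptyset$, let $a\in\mathbb{A}_V$, $a',\tilde a'\in\mathbb{A}_{V'}$, and let $c=(c^1,\dots,c^N)$ be a vector of strictly positive reals, such that $N^{\rm eff}(a,c)$, $N^{\rm eff}(a',c)$ and $N^{\rm eff}(\tilde a',c)$ are all positive. Then all of the following hold. 1. (Extremes) $1\le N^{\rm eff}(a,c)\le |V|$, and $N^{\rm eff}(a,c)=|V|$ whenever $a^{ij}=|V|^{-1}\mathbb{I}(i,j\in V)$ for all $i,j\in[N]$. 2. (Subadditivity) $N^{\rm eff}(a+a',c)\le N^{\rm eff}(a,c)+N^{\rm eff}(a',c)$, with equality only when $$\frac{\sum_{j\in V}c^j}{N^{\rm eff}(a,c)}=\frac{\sum_{j\in V'}c^j}{N^{\rm eff}(a',c)}.$$ 3. (Monotonicity) $N^{\rm eff}(a',c)\le N^{\rm eff}(\tilde a',c)$ implies $N^{\rm eff}(a+a',c)\le N^{\rm eff}(a+\tilde a',c)$, with equality in the latter inequality only when $N^{\rm eff}(a',c)=N^{\rm eff}(\tilde a',c)$. 4. (Lower bound) $N^{\rm eff}(a+a',c)\ge\min\{N^{\rm eff}(a,c),N^{\rm eff}(a',c)\}$.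
   Context: $[N]:=\{1,\dots,N\}$, and $\mathbb{I}$ denotes the indicator. For non-empty $V\subseteq[N]$, $\mathbb{A}_V$ is the set of substochastic $N\times N$ matrices $a=(a^{ij})$ (nonnegative entries, each row sum at most $1$) such that (i) $a$ leaves the uniform distribution $\mu$ on $V$ invariant, i.e. $\mu a=\mu$ with $\mu$ viewed as a row vector on $[N]$ (equivalently $\sum_{i\in V}a^{ij}=1$ for all $j\in V$, given (ii)), and (ii) $a^{ij}=0$ whenever $(i,j)\in[N]^2\setminus V^2$. By convention $\mathbb{A}_\emptyset$ contains only the zero matrix. If $a\in\mathbb{A}_V$, $a'\in\mathbb{A}_{V'}$ and $V\cap V'=\emptyset$, then $a+a'\in\mathbb{A}_{V\cup V'}$. Let $\mathbb{A}:=\bigcup_{V\subseteq[N]}\mathbb{A}_V$. For $a\in\mathbb{A}$ and $c$ a vector of $N$ strictly positive reals, the effective sample size is $N^{\rm eff}(a,c):=0$ if $a\in\mathbb{A}_\emptyset$, and otherwise $$N^{\rm eff}(a,c):=\frac{\left(\sum_{i=1}^N\sum_{j=1}^N a^{ij}c^j\right)^2}{\sum_{i=1}^N\left(\sum_{j=1}^N a^{ij}c^j\right)^2}.$$ *)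

theory Defs
  imports "HOL-Analysis.Analysis"
begin

text \<open>
  The index set \<open>[N]\<close> is the universe of a finite type \<open>'n\<close>, so \<open>N = CARD('n)\<close>.
  The entry \<open>a\<^sup>i\<^sup>j\<close> (row \<open>i\<close>, column \<open>j\<close>) is \<open>a $ i $ j\<close>.
\<close>

definition substochastic :: "real^'n^'n \<Rightarrow> bool" where
  "substochastic a \<longleftrightarrow> (\<forall>i j. 0 \<le> a $ i $ j) \<and> (\<forall>i. (\<Sum>j\<in>UNIV. a $ i $ j) \<le> 1)"

definition uniform_vec :: "'n::finite set \<Rightarrow> real^'n" where
  "uniform_vec V = (\<chi> i. if i \<in> V then 1 / real (card V) else 0)"

definition alpha_matrices :: "'n::finite set \<Rightarrow> (real^'n^'n) set" where
  "alpha_matrices V =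
     (if V = {} then {0}
      else {a. substochastic a \<and> uniform_vec V v* a = uniform_vec V \<and>
               (\<forall>i j. (i, j) \<notin> V \<times> V \<longrightarrow> a $ i $ j = 0)})"

text \<open>
  The effective sample size is meaningful for \<open>a\<close> in some \<open>alpha_matrices V\<close> and
  strictly positive \<open>c\<close>; elsewhere the value of this total function is irrelevant.
\<close>

definition neff :: "real^'n^'n \<Rightarrow> real^'n \<Rightarrow> real" where
  "neff a c =
     (if a \<in> alpha_matrices {} then 0
      else (\<Sum>i\<in>UNIV. \<Sum>j\<in>UNIV. a $ i $ j * c $ j)\<^sup>2
           / (\<Sum>i\<in>UNIV. (\<Sum>j\<in>UNIV. a $ i $ j * c $ j)\<^sup>2))"

end

theory Submission
  imports Defs
begin

text \<open>
  Write \<open>r\<^sub>i\<close> for the \<open>i\<close>-th entry of \<open>a *v c\<close>, \<open>S\<close> for the sum of the \<open>r\<^sub>i\<close> and \<open>Q\<close> for the sum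
  of their squares, so that the effective sample size is \<open>S\<^sup>2 / Q\<close>. Invariance of the uniform
  distribution makes all columns indexed by \<open>V\<close> sum to one, hence \<open>S\<close> depends only on \<open>V\<close> and \<open>c\<close>.
  Disjointness of \<open>V\<close> and \<open>V'\<close> makes both \<open>S\<close> and \<open>Q\<close> additive, and every claim becomes an
  inequality between \<open>(S + S')\<^sup>2 / (Q + Q')\<close> and the two separate quotients.
\<close>

lemma neff_eq: \<comment> \<open>the case \<open>a = 0\<close> is covered because \<open>0 / 0 = 0\<close>\<close>
  fixes a :: "real^'n::finite^'n"
  shows "neff a c = (\<Sum>i\<in>UNIV. (a *v c) $ i)\<^sup>2 / (\<Sum>i\<in>UNIV. ((a *v c) $ i)\<^sup>2)"
  by (simp add: neff_def alpha_matrices_def matrix_vector_mult_def)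

lemma alpha_matrices_nonneg:
  assumes "a \<in> alpha_matrices V"
  shows "0 \<le> a $ i $ j"
  using assms by (auto simp: alpha_matrices_def substochastic_def split: if_splits)

lemma alpha_matrices_eq_0:
  assumes "a \<in> alpha_matrices V" "i \<notin> V \<or> j \<notin> V"
  shows "a $ i $ j = 0"
  using assms by (auto simp: alpha_matrices_def split: if_splits)

text \<open>For \<open>j\<close> in \<open>V\<close>, coordinate \<open>j\<close> of the invariance
  equation is the column sum times the constant weight \<open>1 / card V\<close>, which cancels.
  Empty \<open>V\<close> falls under the vanishing columns.\<close>

lemma alpha_matrices_column_sum:
  fixes V :: "'n::finite set"
  assumes a: "a \<in> alpha_matrices V"
  shows "(\<Sum>i\<in>UNIV. a $ i $ j) = (if j \<in> V then 1 else 0)"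
proof (cases "j \<in> V")
  case True
  then have pos: "0 < real (card V)"
    by (auto simp: card_gt_0_iff)
  have "uniform_vec V v* a = uniform_vec V"
    using a True by (auto simp: alpha_matrices_def split: if_splits)
  then have "(uniform_vec V v* a) $ j = 1 / real (card V)"
    using True by (simp add: uniform_vec_def)
  moreover have "(uniform_vec V v* a) $ j = (\<Sum>i\<in>UNIV. a $ i $ j / real (card V))"
    unfolding vector_matrix_mult_def
    by (auto simp: uniform_vec_def alpha_matrices_eq_0[OF a] intro!: sum.cong)
  ultimately show ?thesis
    using True pos by (auto simp flip: sum_divide_distrib)
qed (simp add: alpha_matrices_eq_0[OF a])

lemma alpha_matrices_sum_mult_vec:
  assumes a: "a \<in> alpha_matrices V"
  shows "(\<Sum>i\<in>UNIV. (a *v c) $ i) = (\<Sum>j\<in>V. c $ j)"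
proof -
  have "(\<Sum>i\<in>UNIV. (a *v c) $ i) = (\<Sum>j\<in>UNIV. (\<Sum>i\<in>UNIV. a $ i $ j) * c $ j)"
    unfolding matrix_vector_mult_def by (simp add: sum_distrib_right) (rule sum.swap)
  also have "\<dots> = (\<Sum>j\<in>UNIV. if j \<in> V then c $ j else 0)"
    by (intro sum.cong) (auto simp: alpha_matrices_column_sum[OF a])
  also have "\<dots> = (\<Sum>j\<in>V. c $ j)"
    by (simp add: sum.If_cases)
  finally show ?thesis .
qed

lemma alpha_matrices_mult_vec_nonneg:
  assumes "a \<in> alpha_matrices V" "\<forall>j. 0 < c $ j"
  shows "0 \<le> (a *v c) $ i"
  using assms(2) alpha_matrices_nonneg[OF assms(1)]
  by (simp add: matrix_vector_mult_def sum_nonneg less_imp_le)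

lemma alpha_matrices_mult_vec_eq_0:
  assumes "a \<in> alpha_matrices V" "i \<notin> V"
  shows "(a *v c) $ i = 0"
  using alpha_matrices_eq_0[OF assms(1)] assms(2) by (simp add: matrix_vector_mult_def)

text \<open>The two weighted row sum vectors have disjoint supports, so the cross term of each
  square vanishes.\<close>

lemma alpha_matrices_sum_squares_add:
  fixes V V' :: "'n::finite set"
  assumes a: "a \<in> alpha_matrices V" and a': "a' \<in> alpha_matrices V'" and "V \<inter> V' = {}"
  shows "(\<Sum>i\<in>UNIV. (((a + a') *v c) $ i)\<^sup>2)
       = (\<Sum>i\<in>UNIV. ((a *v c) $ i)\<^sup>2) + (\<Sum>i\<in>UNIV. ((a' *v c) $ i)\<^sup>2)"
proof -
  have "(((a + a') *v c) $ i)\<^sup>2 = ((a *v c) $ i)\<^sup>2 + ((a' *v c) $ i)\<^sup>2" for i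
  proof -
    have "(a *v c) $ i = 0 \<or> (a' *v c) $ i = 0"
      using assms(3) alpha_matrices_mult_vec_eq_0[OF a] alpha_matrices_mult_vec_eq_0[OF a'] by blast
    then show ?thesis
      by (auto simp: matrix_vector_mult_add_rdistrib)
  qed
  then show ?thesis
    by (simp add: sum.distrib)
qed

text \<open>Each \<open>f i\<close> is at most the whole sum; multiplying by \<open>f i\<close> and
  summing gives the bound.\<close>

lemma sum_squares_le_square_sum:
  fixes f :: "'a \<Rightarrow> real"
  assumes "finite A" "\<And>i. i \<in> A \<Longrightarrow> 0 \<le> f i"
  shows "(\<Sum>i\<in>A. (f i)\<^sup>2) \<le> (\<Sum>i\<in>A. f i)\<^sup>2"
proof -
  have "(\<Sum>i\<in>A. f i * f i) \<le> (\<Sum>i\<in>A. f i * (\<Sum>j\<in>A. f j))"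
    using assms by (intro sum_mono mult_left_mono member_le_sum) auto
  then show ?thesis
    by (simp add: power2_eq_square sum_distrib_right)
qed

lemma neff_bounds:
  fixes V :: "'n::finite set"
  assumes a: "a \<in> alpha_matrices V" and c: "\<forall>j. 0 < c $ j" and pos: "0 < neff a c"
  shows "1 \<le> neff a c" "neff a c \<le> real (card V)"
proof -
  define r where "r i = (a *v c) $ i" for i
  have neff: "neff a c = (\<Sum>i\<in>UNIV. r i)\<^sup>2 / (\<Sum>i\<in>UNIV. (r i)\<^sup>2)"
    by (simp add: neff_eq r_def)
  \<comment> \<open>Division by zero yields 0, so a positive quotient excludes a zero
    denominator.\<close>
  then have Q: "0 < (\<Sum>i\<in>UNIV. (r i)\<^sup>2)"
    using pos by (auto simp: zero_less_divide_iff sum_nonneg not_less[symmetric])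
  have "(\<Sum>i\<in>UNIV. (r i)\<^sup>2) \<le> (\<Sum>i\<in>UNIV. r i)\<^sup>2"
    using alpha_matrices_mult_vec_nonneg[OF a c] by (intro sum_squares_le_square_sum) (auto simp: r_def)
  then show "1 \<le> neff a c"
    using Q by (simp add: neff)
  have supp: "r i = 0" if "i \<notin> V" for i
    using alpha_matrices_mult_vec_eq_0[OF a that] by (simp add: r_def)
  \<comment> \<open>Cauchy-Schwarz is applied on \<open>V\<close> rather than on all indices, so
    that the constant is \<open>card V\<close>.\<close>
  have "(\<Sum>i\<in>V. r i)\<^sup>2 \<le> real (card V) * (\<Sum>i\<in>V. (r i)\<^sup>2)"
    using Cauchy_Schwarz_ineq_sum[of "\<lambda>_. 1" r V] by simp
  also have "(\<Sum>i\<in>V. r i) = (\<Sum>i\<in>UNIV. r i)"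
    using supp by (intro sum.mono_neutral_left) auto
  also have "(\<Sum>i\<in>V. (r i)\<^sup>2) = (\<Sum>i\<in>UNIV. (r i)\<^sup>2)"
    using supp by (intro sum.mono_neutral_left) auto
  finally show "neff a c \<le> real (card V)"
    using Q by (simp add: neff pos_divide_le_eq)
qed

text \<open>All rows in \<open>V\<close> have the same weighted sum, which is the equality case of
  Cauchy-Schwarz. For empty \<open>V\<close> both sides are 0.\<close>

lemma neff_uniform:
  fixes V :: "'n::finite set"
  assumes a: "\<forall>i j. a $ i $ j = (if i \<in> V \<and> j \<in> V then 1 / real (card V) else 0)"
    and c: "\<forall>j. 0 < c $ j"
  shows "neff a c = real (card V)"
proof (cases "V = {}")
  case True
  then show ?thesis
    using a by (simp add: neff_eq matrix_vector_mult_def)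
next
  case False
  define C where "C = (\<Sum>j\<in>V. c $ j)"
  have C: "0 < C"
    using False c unfolding C_def by (intro sum_pos) auto
  have card: "0 < real (card V)"
    using False by (simp add: card_gt_0_iff)
  have r: "(a *v c) $ i = (if i \<in> V then C / real (card V) else 0)" for i
  proof -
    have "(\<Sum>j\<in>UNIV. a $ i $ j * c $ j) = (\<Sum>j\<in>V. a $ i $ j * c $ j)"
      using a by (intro sum.mono_neutral_right) auto
    then show ?thesis
      using a by (auto simp: matrix_vector_mult_def C_def sum_divide_distrib)
  qed
  have "((a *v c) $ i)\<^sup>2 = (if i \<in> V then (C / real (card V))\<^sup>2 else 0)" for i
    by (simp add: r)
  with r show ?thesis
    using C card by (simp add: neff_eq sum.If_cases power2_eq_square)
qed

text \<open>The gap between the two sides is a perfect square over a positive denominator, which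
  settles the inequality and its equality case together.\<close>

lemma add_square_divide_le:
  fixes S S' Q Q' :: real
  assumes "0 < Q" "0 < Q'"
  shows "(S + S')\<^sup>2 / (Q + Q') \<le> S\<^sup>2 / Q + S'\<^sup>2 / Q'"
    and "(S + S')\<^sup>2 / (Q + Q') = S\<^sup>2 / Q + S'\<^sup>2 / Q' \<longleftrightarrow> S * Q' = S' * Q"
proof -
  have diff: "S\<^sup>2 / Q + S'\<^sup>2 / Q' - (S + S')\<^sup>2 / (Q + Q') = (S * Q' - S' * Q)\<^sup>2 / (Q * Q' * (Q + Q'))"
    using assms by (simp add: divide_simps add_pos_pos less_imp_neq[THEN not_sym] power2_eq_square) algebra
  have "0 \<le> (S * Q' - S' * Q)\<^sup>2 / (Q * Q' * (Q + Q'))"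
    using assms by simp
  with diff show "(S + S')\<^sup>2 / (Q + Q') \<le> S\<^sup>2 / Q + S'\<^sup>2 / Q'"
    by linarith
  have "(S * Q' - S' * Q)\<^sup>2 / (Q * Q' * (Q + Q')) = 0 \<longleftrightarrow> S * Q' = S' * Q"
    using assms by auto
  with diff show "(S + S')\<^sup>2 / (Q + Q') = S\<^sup>2 / Q + S'\<^sup>2 / Q' \<longleftrightarrow> S * Q' = S' * Q"
    by linarith
qed

text \<open>With \<open>m\<close> the minimum, the bounds \<open>m * Q \<le> S\<^sup>2\<close> and
  \<open>m * Q' \<le> S'\<^sup>2\<close> add up, and the cross term of
  \<open>(S + S')\<^sup>2\<close> is nonnegative.\<close>

lemma min_le_add_square_divide:
  fixes S S' Q Q' :: real
  assumes "0 < Q" "0 < Q'" "0 \<le> S" "0 \<le> S'"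
  shows "min (S\<^sup>2 / Q) (S'\<^sup>2 / Q') \<le> (S + S')\<^sup>2 / (Q + Q')"
proof -
  define m where "m = min (S\<^sup>2 / Q) (S'\<^sup>2 / Q')"
  have "m * Q \<le> S\<^sup>2" "m * Q' \<le> S'\<^sup>2"
    using assms by (simp_all add: m_def flip: pos_le_divide_eq)
  moreover have "S\<^sup>2 + S'\<^sup>2 \<le> (S + S')\<^sup>2"
    using assms by (simp add: power2_sum)
  ultimately have "m * (Q + Q') \<le> (S + S')\<^sup>2"
    by (simp add: distrib_left)
  then show ?thesis
    using assms by (simp add: m_def pos_le_divide_eq)
qed

theorem proposition1:
  fixes V V' :: "'n::finite set"
    and a a' at' :: "real^'n^'n"
    and c :: "real^'n"
  assumes "V \<inter> V' = {}"
    and "a \<in> alpha_matrices V"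
    and "a' \<in> alpha_matrices V'"
    and "at' \<in> alpha_matrices V'"
    and "\<forall>j. 0 < c $ j"
    and "0 < neff a c"
    and "0 < neff a' c"
    and "0 < neff at' c"
  shows "(1 \<le> neff a c \<and> neff a c \<le> real (card V) \<and>
          ((\<forall>i j. a $ i $ j = (if i \<in> V \<and> j \<in> V then 1 / real (card V) else 0)) \<longrightarrow>
             neff a c = real (card V))) \<and>
         (neff (a + a') c \<le> neff a c + neff a' c \<and>
          (neff (a + a') c = neff a c + neff a' c \<longrightarrow>
             (\<Sum>j\<in>V. c $ j) / neff a c = (\<Sum>j\<in>V'. c $ j) / neff a' c)) \<and>
         (neff a' c \<le> neff at' c \<longrightarrow>
            neff (a + a') c \<le> neff (a + at') c \<and>
            (neff (a + a') c = neff (a + at') c \<longrightarrow> neff a' c = neff at' c)) \<and>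
         neff (a + a') c \<ge> min (neff a c) (neff a' c)"
proof -
  define S where "S W = (\<Sum>j\<in>W. c $ j)" for W
  define Q where "Q b = (\<Sum>i\<in>UNIV. ((b *v c) $ i)\<^sup>2)" for b :: "real^'n^'n"
  have neff: "neff b c = (S W)\<^sup>2 / Q b" if "b \<in> alpha_matrices W" for b W
    by (simp add: neff_eq S_def Q_def alpha_matrices_sum_mult_vec[OF that])
  have neff_add: "neff (a + b) c = (S V + S V')\<^sup>2 / (Q a + Q b)" if "b \<in> alpha_matrices V'" for b
    using alpha_matrices_sum_mult_vec[OF assms(2), of c] alpha_matrices_sum_mult_vec[OF that, of c]
      alpha_matrices_sum_squares_add[OF assms(2) that assms(1), of c]
    by (simp add: neff_eq S_def Q_def matrix_vector_mult_add_rdistrib sum.distrib)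
  have S_nonneg: "0 \<le> S W" for W
    using assms(5) by (simp add: S_def sum_nonneg less_imp_le)
  have Q_nonneg: "0 \<le> Q b" for b
    by (simp add: Q_def sum_nonneg)
  have pos: "0 < S W \<and> 0 < Q b" if "b \<in> alpha_matrices W" "0 < neff b c" for b W
    using that neff[OF that(1)] S_nonneg[of W] Q_nonneg[of b] by (auto simp: zero_less_divide_iff)
  note pos_a = pos[OF assms(2,6)] and pos_a' = pos[OF assms(3,7)] and pos_at' = pos[OF assms(4,8)]
  note neffs = neff[OF assms(2)] neff[OF assms(3)] neff[OF assms(4)]
    neff_add[OF assms(3)] neff_add[OF assms(4)]

  have extremes: "1 \<le> neff a c" "neff a c \<le> real (card V)"
    using neff_bounds[OF assms(2,5,6)] .
  have uniform: "(\<forall>i j. a $ i $ j = (if i \<in> V \<and> j \<in> V then 1 / real (card V) else 0)) \<longrightarrow>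
      neff a c = real (card V)"
    using neff_uniform[OF _ assms(5)] by blast
  have subadditive: "neff (a + a') c \<le> neff a c + neff a' c"
    using pos_a pos_a' by (simp add: neffs add_square_divide_le)
  have subadditive_eq: "S V / neff a c = S V' / neff a' c"
    if "neff (a + a') c = neff a c + neff a' c"
  proof -
    \<comment> \<open>As \<open>S V / neff a c = Q a / S V\<close>, and likewise for
      \<open>a'\<close>, the goal is this equality criterion after cross-multiplication.\<close>
    have "S V * Q a' = S V' * Q a"
      using that pos_a pos_a' by (simp add: neffs add_square_divide_le)
    then show ?thesis
      using pos_a pos_a' by (simp add: neffs power2_eq_square field_simps)
  qed
  have monotone: "neff (a + a') c \<le> neff (a + at') c" if "neff a' c \<le> neff at' c"
  proof -
    \<comment> \<open>Both quotients have the numerator \<open>(S V')\<^sup>2\<close>, since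
      \<open>a'\<close> and \<open>at'\<close> belong to the same \<open>V'\<close>; comparing them
      reverses the order of the denominators.\<close>
    have "Q at' \<le> Q a'"
      using that pos_a' pos_at' by (simp add: neffs divide_le_cancel field_simps)
    then show ?thesis
      using pos_a pos_at' by (auto simp: neffs intro!: divide_left_mono add_pos_pos)
  qed
  have monotone_eq: "neff a' c = neff at' c" if "neff (a + a') c = neff (a + at') c"
  proof -
    \<comment> \<open>A nonzero common numerator lets equal quotients force equal
      denominators.\<close>
    have "S V + S V' \<noteq> 0" "Q a + Q a' \<noteq> 0" "Q a + Q at' \<noteq> 0"
      using pos_a pos_a' pos_at' by linarith+
    then have "Q a' = Q at'"
      using that by (simp add: neffs frac_eq_eq)
    then show ?thesis
      by (simp add: neffs)
  qed
  have lower: "min (neff a c) (neff a' c) \<le> neff (a + a') c"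
    using pos_a pos_a' S_nonneg by (simp add: neffs min_le_add_square_divide)
  show ?thesis
    using extremes uniform subadditive subadditive_eq monotone monotone_eq lower
    unfolding S_def by blast
qed

end
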